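(* The set \[ \bigg\{ \sum_{n=1}^{\infty} \frac{1}{\prod_{i=1}^{f(n)}(n+i)} \,:\, (f(n))_{n=1}^{\infty}\in\mathbb{N}^{\mathbb{N}},\ \lim_{n\to\infty} f(n) = \infty \bigg\} \] is equal to the whole interval $(0,\infty)$.
   Context: $\mathbb{N}$ denotes the set of positive integers, and $\mathbb{N}^{\mathbb{N}}$ the set of all sequences of positive integers. *)

theory Defs imports Complex_Main begin

end

theory Submission imports Defs "HOL-Analysis.Summation_Tests" begin

text \<open>
  Write \<open>T k n = 1 / ((n + 1) \<cdots> (n + k))\<close>; the tail \<open>\<Sum>i\<ge>n. T (k + 1) i\<close> telescopes to
  \<open>T k n / k\<close>. A given \<open>x > 0\<close> is expanded greedily. Suppose the remainder at \<open>n\<close> is at most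
  \<open>T k n\<close>. Spending negligible terms, wait until it exceeds \<open>T k\<close> for the first time and then
  subtract \<open>T k\<close>: what remains is smaller than the tail at level \<open>k + 1\<close>, as soon as
  \<open>n\<close> is large compared with \<open>k\<^sup>2\<close>. Repeat this until \<open>n\<close> is also large compared with
  \<open>(k + 1)\<^sup>2\<close>. Subtracting terms \<open>T (k + 1)\<close> therefore brings the
  remainder down to at most \<open>T (k + 1)\<close>, and one continues with \<open>k + 1\<close>. The wait is
  essential: with the constraint \<open>f \<ge> k\<close> growing at predetermined places, the set of attainable
  sums has gaps, because \<open>T k n\<close> exceeds the tail at level \<open>k + 1\<close> for \<open>k \<ge> 2\<close>.
\<close>

section \<open>The terms: telescoping and decay\<close>

definition rterm :: "nat \<Rightarrow> nat \<Rightarrow> real" where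
  "rterm k n = 1 / (\<Prod>i = 1..k. real (n + i))"

lemma rterm_pos: "0 < rterm k n"
  unfolding rterm_def by (intro divide_pos_pos prod_pos) auto

lemma rterm_0: "rterm 0 n = 1"
  by (simp add: rterm_def)

lemma rterm_Suc: "rterm (Suc k) n = rterm k n / real (n + Suc k)"
  by (simp add: rterm_def)

text \<open>Passing from \<open>n\<close> to \<open>Suc n\<close> drops the factor
  \<open>n + 1\<close> of the product and gains the factor \<open>n + k + 1\<close>.\<close>

lemma rterm_shift: "rterm k (Suc n) = rterm k n * real (Suc n) / real (n + Suc k)"
proof (induction k)
  case 0
  then show ?case by (simp add: rterm_0)
next
  case (Suc k)
  have "rterm (Suc k) (Suc n) = rterm k (Suc n) / real (Suc n + Suc k)"
    by (rule rterm_Suc)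
  also have "\<dots> = rterm k n * real (Suc n) / real (n + Suc k) / real (n + Suc (Suc k))"
    unfolding Suc.IH by simp
  also have "\<dots> = rterm (Suc k) n * real (Suc n) / real (n + Suc (Suc k))"
    by (simp add: rterm_Suc)
  finally show ?case .
qed

lemma rterm_diff: "rterm k n - rterm k (Suc n) = real k * rterm (Suc k) n"
  unfolding rterm_shift rterm_Suc by (simp add: field_simps)

lemma sum_rterm_Suc:
  assumes "n \<le> m"
  shows "real k * (\<Sum>i = n..<m. rterm (Suc k) i) = rterm k n - rterm k m"
  using assms
proof (induction rule: dec_induct)
  case (step m)
  then show ?case using rterm_diff[of k m] by (simp add: algebra_simps)
qed simp

lemma rterm_antimono: "k \<le> l \<Longrightarrow> rterm l n \<le> rterm k n"
proof (induction rule: dec_induct)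
  case (step l)
  have "rterm (Suc l) n \<le> rterm l n"
    using rterm_pos[of l n] unfolding rterm_Suc by (simp add: divide_le_eq mult_le_cancel_left1)
  with step show ?case by simp
qed simp

lemma rterm_tendsto_0:
  assumes "1 \<le> k"
  shows "(\<lambda>n. rterm k n) \<longlonglongrightarrow> 0"
proof (rule tendsto_sandwich[OF _ _ tendsto_const])
  show "\<forall>\<^sub>F n in sequentially. 0 \<le> rterm k n"
    using rterm_pos by (simp add: less_imp_le)
  show "\<forall>\<^sub>F n in sequentially. rterm k n \<le> inverse (real (Suc n))"
    using rterm_antimono[OF assms] by (simp add: rterm_def divide_inverse add.commute)
  show "(\<lambda>n. inverse (real (Suc n))) \<longlonglongrightarrow> 0"
    by (rule LIMSEQ_inverse_real_of_nat)
qed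

text \<open>For \<open>n \<ge> 1\<close> every factor of the product is at least 2. The bound does
  not depend on \<open>n\<close>, so all terms of a finite stretch become small together.\<close>

lemma rterm_le_half_power: "1 \<le> n \<Longrightarrow> rterm k n \<le> (1/2) ^ k"
proof (induction k)
  case (Suc k)
  have "rterm (Suc k) n = rterm k n * (1 / real (n + Suc k))"
    by (simp add: rterm_Suc)
  also have "\<dots> \<le> (1/2) ^ k * (1/2)"
    using Suc by (intro mult_mono) (auto simp: field_simps)
  finally show ?case by simp
qed (simp add: rterm_0)

text \<open>Supplies the negligible terms: one large constant value, used on the whole stretch,
  makes waiting as cheap as desired.\<close>

lemma exists_const_sum_rterm_less:
  assumes "1 \<le> n" "0 < \<epsilon>"
  shows "\<exists>K\<ge>k. (\<Sum>i = n..<m. rterm K i) < \<epsilon>"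
proof -
  have "(\<lambda>K. real (m - n) * (1/2) ^ K) \<longlonglongrightarrow> real (m - n) * 0"
    by (intro tendsto_mult tendsto_const LIMSEQ_power_zero) simp
  then have "\<forall>\<^sub>F K in sequentially. real (m - n) * (1/2) ^ K < \<epsilon>"
    using assms by (auto dest: order_tendstoD)
  then have "\<forall>\<^sub>F K in sequentially. real (m - n) * (1/2) ^ K < \<epsilon> \<and> k \<le> K"
    by (intro eventually_conj eventually_ge_at_top)
  then obtain K where K: "real (m - n) * (1/2) ^ K < \<epsilon>" "k \<le> K"
    by (auto dest: eventually_happens)
  have "(\<Sum>i = n..<m. rterm K i) \<le> (\<Sum>i = n..<m. (1/2) ^ K)"
    using assms by (intro sum_mono rterm_le_half_power) auto
  with K show ?thesis by auto
qed

section \<open>Stretches of the expansion and their remainders\<close>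

text \<open>Here \<open>r\<close> is the remainder before the term at \<open>n\<close> is spent, and
  \<open>s\<close> the one before the term at \<open>m\<close>. The choice function is hidden, so
  that stretches compose by \<open>reach_trans\<close> without naming it.\<close>

definition reach :: "nat \<Rightarrow> nat \<Rightarrow> real \<Rightarrow> nat \<Rightarrow> real \<Rightarrow> bool" where
  "reach k n r m s \<longleftrightarrow>
     n \<le> m \<and> (\<exists>g. (\<forall>i\<in>{n..<m}. k \<le> g i) \<and> s = r - (\<Sum>i = n..<m. rterm (g i) i))"

lemma reach_const: "k \<le> K \<Longrightarrow> n \<le> m \<Longrightarrow> reach k n r m (r - (\<Sum>i = n..<m. rterm K i))"
  unfolding reach_def by (intro conjI exI[of _ "\<lambda>_. K"]) auto

lemma reach_step: "k \<le> K \<Longrightarrow> reach k n r (Suc n) (r - rterm K n)"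
  using reach_const[of k K n "Suc n" r] by simp

lemma reach_mono: "reach l n r m s \<Longrightarrow> k \<le> l \<Longrightarrow> reach k n r m s"
  unfolding reach_def by (elim conjE exE, intro conjI exI) (auto intro: order_trans)

lemma reach_trans:
  assumes "reach k n r m s" "reach k m s p t"
  shows "reach k n r p t"
proof -
  obtain g where g: "n \<le> m" "\<forall>i\<in>{n..<m}. k \<le> g i" "s = r - (\<Sum>i = n..<m. rterm (g i) i)"
    using assms(1) by (auto simp: reach_def)
  obtain h where h: "m \<le> p" "\<forall>i\<in>{m..<p}. k \<le> h i" "t = s - (\<Sum>i = m..<p. rterm (h i) i)"
    using assms(2) by (auto simp: reach_def)
  define f where "f = (\<lambda>i. if i < m then g i else h i)"
  have "(\<Sum>i = n..<p. rterm (f i) i) = (\<Sum>i = n..<m. rterm (f i) i) + (\<Sum>i = m..<p. rterm (f i) i)"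
    using g h by (simp add: sum.atLeastLessThan_concat)
  also have "\<dots> = (\<Sum>i = n..<m. rterm (g i) i) + (\<Sum>i = m..<p. rterm (h i) i)"
    by (intro arg_cong2[of _ _ _ _ "(+)"] sum.cong) (auto simp: f_def)
  finally have "t = r - (\<Sum>i = n..<p. rterm (f i) i)"
    using g h by simp
  moreover have "\<forall>i\<in>{n..<p}. k \<le> f i"
    using g h by (auto simp: f_def)
  ultimately show ?thesis
    using g h by (auto simp: reach_def)
qed

text \<open>With the constant choice \<open>k\<close>, stop just before the term that would bring
  the remainder to 0 or below; that term is then at least the remainder.\<close>

lemma reach_descend:
  assumes "0 < r" "r \<le> (\<Sum>i = n..<p. rterm k i)"
  shows "\<exists>m s. reach k n r m s \<and> 0 < s \<and> s \<le> rterm k m"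
proof -
  define q where "q = (LEAST q. r \<le> (\<Sum>i = n..<q. rterm k i))"
  have q: "r \<le> (\<Sum>i = n..<q. rterm k i)"
    unfolding q_def using assms(2) by (rule LeastI)
  have min: "(\<Sum>i = n..<m. rterm k i) < r" if "m < q" for m
    using not_less_Least[of m] that unfolding q_def by fastforce
  have "n < q"
    using q assms(1) by (cases "n < q") auto
  then obtain m where m: "q = Suc m" "n \<le> m"
    by (cases q) auto
  have "reach k n r m (r - (\<Sum>i = n..<m. rterm k i))"
    using m by (intro reach_const) auto
  moreover have "0 < r - (\<Sum>i = n..<m. rterm k i)"
    using min[of m] m by simp
  moreover have "r - (\<Sum>i = n..<m. rterm k i) \<le> rterm k m"
    using q m by simp
  ultimately show ?thesis by blast
qed

section \<open>Passing from level k to level k + 1\<close>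

text \<open>Bounds the overshoot when the remainder first exceeds \<open>rterm k\<close> between
  \<open>j\<close> and \<open>Suc j\<close>. After division by \<open>rterm k j\<close> the claim
  reads \<open>k\<^sup>2 * (j + k + 2) < (j + 1) * (j + 2)\<close>, and \<open>j + k + 2\<close> is
  at most \<open>3 * (j + 1)\<close>; hence the constant 3.\<close>

lemma rterm_diff_less:
  assumes "1 \<le> k" "3 * k\<^sup>2 \<le> j"
  shows "rterm k j - rterm k (Suc j) < rterm k (Suc (Suc j)) / real k"
proof -
  have "k \<le> k\<^sup>2"
    by (simp add: power2_eq_square)
  with assms have "k \<le> j" by linarith
  then have "k\<^sup>2 * (j + k + 2) \<le> k\<^sup>2 * (3 * (j + 1))"
    by (intro mult_le_mono2) simp
  also have "\<dots> = 3 * k\<^sup>2 * (j + 1)" by (simp add: algebra_simps)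
  also have "\<dots> < (j + 2) * (j + 1)"
    using assms by (intro mult_strict_right_mono) auto
  finally have "real (k\<^sup>2 * (j + k + 2)) < real ((j + 2) * (j + 1))"
    by (simp only: of_nat_less_iff)
  then have "real k * (real k * (j + k + 2)) < (real j + 1) * (real j + 2)"
    by (simp add: power2_eq_square algebra_simps)
  then have "real k < ((real j + 1) * (real j + 2)) / (real k * (j + k + 2))"
    using assms by (subst pos_less_divide_eq) auto
  then have "real k / (j + k + 1) < ((real j + 1) * (real j + 2)) / (real k * (j + k + 2)) / (j + k + 1)"
    by (intro divide_strict_right_mono) auto
  then have "real k / (j + k + 1)
      < ((real j + 1) * (real j + 2)) / (real k * (j + k + 1) * (j + k + 2))"
    by (simp add: ac_simps)
  then have "rterm k j * (real k / (j + k + 1))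
      < rterm k j * (((real j + 1) * (real j + 2)) / (real k * (j + k + 1) * (j + k + 2)))"
    using rterm_pos by (intro mult_strict_left_mono)
  moreover have "rterm k j - rterm k (Suc j) = rterm k j * (real k / (j + k + 1))"
    by (simp add: rterm_diff rterm_Suc add.commute)
  moreover have "rterm k (Suc (Suc j)) / real k
      = rterm k j * (((real j + 1) * (real j + 2)) / (real k * (j + k + 1) * (j + k + 2)))"
    unfolding rterm_shift by (simp add: ac_simps)
  ultimately show ?thesis by simp
qed

lemma reach_cross:
  assumes "1 \<le> k" "3 * k\<^sup>2 \<le> n" "0 < r" "r \<le> rterm k n"
  shows "\<exists>m s. reach k n r m s \<and> n < m \<and> 0 < s \<and> s < rterm k m / real k"
proof -
  \<comment> \<open>The wait costs less than \<open>r / 2\<close>, while \<open>rterm k p\<close>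
    falls below the half that is left; so a crossing occurs at \<open>p\<close> at the
    latest.\<close>
  have "\<forall>\<^sub>F p in sequentially. rterm k p < r / 2"
    using order_tendstoD(2)[OF rterm_tendsto_0[OF assms(1)], of "r / 2"] assms(3) by simp
  then have "\<forall>\<^sub>F p in sequentially. rterm k p < r / 2 \<and> n \<le> p"
    by (intro eventually_conj eventually_ge_at_top)
  then obtain p where p: "rterm k p < r / 2" "n \<le> p"
    by (auto dest: eventually_happens)
  have "1 \<le> n" using assms by (cases n) auto
  then obtain K where K: "k \<le> K" "(\<Sum>i = n..<p. rterm K i) < r / 2"
    using exists_const_sum_rterm_less[of n "r/2" k p] assms by auto
  define R where "R q = r - (\<Sum>i = n..<q. rterm K i)" for q
  define q where "q = (LEAST q. n \<le> q \<and> rterm k q < R q)"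
  have "n \<le> p \<and> rterm k p < R p"
    using p K by (simp add: R_def)
  then have q: "n \<le> q \<and> rterm k q < R q"
    unfolding q_def by (rule LeastI)
  \<comment> \<open>The assumption \<open>r \<le> rterm k n\<close> excludes a crossing at the
    start, so \<open>q\<close> has a predecessor \<open>j\<close> where the remainder is still at
    most \<open>rterm k j\<close>.\<close>
  have "q \<noteq> n"
    using q assms by (auto simp: R_def)
  then obtain j where j: "q = Suc j" "n \<le> j"
    using q by (cases q) auto
  have "R j \<le> rterm k j"
    using not_less_Least[of j "\<lambda>q. n \<le> q \<and> rterm k q < R q"] j
    unfolding q_def[symmetric] by auto
  moreover have "R q \<le> R j"
    using j rterm_pos[of K j] by (simp add: R_def)
  moreover have "rterm k j - rterm k q < rterm k (Suc q) / real k"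
    using rterm_diff_less[of k j] assms j by simp
  ultimately have "R q - rterm k q < rterm k (Suc q) / real k"
    by linarith
  moreover have "reach k n r (Suc q) (R q - rterm k q)"
    using reach_const[of k K n q r] reach_step[of k k q "R q"] K q
    by (auto simp: R_def intro: reach_trans)
  ultimately show ?thesis
    using q by (intro exI[of _ "Suc q"] exI[of _ "R q - rterm k q"]) auto
qed

text \<open>A crossing advances the index and, as \<open>k \<ge> 1\<close>, restores the hypotheses
  of \<open>reach_cross\<close>; so crossings at level \<open>k\<close> can be iterated past any
  \<open>L\<close>.\<close>

lemma reach_cross_beyond:
  assumes "1 \<le> k" "3 * k\<^sup>2 \<le> n" "0 < r" "r \<le> rterm k n"
  shows "\<exists>m s. reach k n r m s \<and> n < m \<and> L \<le> m \<and> 0 < s \<and> s < rterm k m / real k"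
proof (induction L)
  case 0
  then show ?case using reach_cross[OF assms] by simp
next
  case (Suc L)
  then obtain m s where m: "reach k n r m s" "n < m" "L \<le> m" "0 < s" "s < rterm k m / real k"
    by blast
  have "rterm k m / real k \<le> rterm k m"
    using assms rterm_pos[of k m] by (simp add: divide_le_eq mult_le_cancel_left1)
  then obtain p t where "reach k m s p t" "m < p" "0 < t" "t < rterm k p / real k"
    using reach_cross[of k m s] assms m by force
  with m show ?case
    by (intro exI[of _ p] exI[of _ t]) (auto intro: reach_trans)
qed

lemma reach_next_level:
  assumes "1 \<le> k" "3 * k\<^sup>2 \<le> n" "0 < r" "r \<le> rterm k n"
  shows "\<exists>m s. reach k n r m s \<and> n < m \<and> L \<le> m \<and> 0 < s \<and> s \<le> rterm (Suc k) m"
proof -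
  obtain m s where m: "reach k n r m s" "n < m" "L \<le> m" "0 < s" "s < rterm k m / real k"
    using reach_cross_beyond[OF assms] by blast
  have "s * real k < rterm k m"
    using m assms by (simp add: field_simps)
  \<comment> \<open>The bound on \<open>s\<close> is strict, so a finite part of the tail at level
    \<open>Suc k\<close> already covers \<open>s\<close>; \<open>p\<close> is where that part
    ends.\<close>
  then have "\<forall>\<^sub>F p in sequentially. rterm k p < rterm k m - s * real k"
    using order_tendstoD(2)[OF rterm_tendsto_0[OF assms(1)], of "rterm k m - s * real k"] by simp
  then have "\<forall>\<^sub>F p in sequentially. rterm k p < rterm k m - s * real k \<and> m \<le> p"
    by (intro eventually_conj eventually_ge_at_top)
  then obtain p where p: "rterm k p < rterm k m - s * real k" "m \<le> p"
    by (auto dest: eventually_happens)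
  have "real k * s \<le> real k * (\<Sum>i = m..<p. rterm (Suc k) i)"
    using p by (simp add: sum_rterm_Suc mult.commute)
  then have "s \<le> (\<Sum>i = m..<p. rterm (Suc k) i)"
    using assms by simp
  then obtain q t where q: "reach (Suc k) m s q t" "0 < t" "t \<le> rterm (Suc k) q"
    using reach_descend m by blast
  then have "m \<le> q" by (simp add: reach_def)
  moreover have "reach k n r q t"
    using m(1) reach_mono[OF q(1), of k] reach_trans by auto
  ultimately show ?thesis
    using m q by (intro exI[of _ q] exI[of _ t]) auto
qed

section \<open>Expanding a given positive number\<close>

text \<open>Level 1 has harmonic terms; their divergence lets the descent handle arbitrarily large
  \<open>x\<close>.\<close>

lemma reach_start:
  assumes "0 < x"
  shows "\<exists>m s. reach 1 1 x m s \<and> 3 \<le> m \<and> 0 < s \<and> s \<le> rterm 1 m"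
proof -
  \<comment> \<open>Indices 1 and 2 get negligible terms, since crossing at level 1 requires an
    index of at least \<open>3 * 1\<^sup>2\<close>.\<close>
  obtain K where K: "1 \<le> K" "(\<Sum>i = 1..<3. rterm K i) < x"
    using exists_const_sum_rterm_less[of 1 x 1 3] assms by auto
  define r where "r = x - (\<Sum>i = 1..<3. rterm K i)"
  have r: "reach 1 1 x 3 r" "0 < r"
    using K reach_const[of 1 K 1 3 x] by (auto simp: r_def)
  have "\<not> summable (\<lambda>i. rterm 1 (i + 3))"
  proof
    assume "summable (\<lambda>i. rterm 1 (i + 3))"
    then have "summable (\<lambda>i. inverse (real (i + 4)))"
      by (simp add: rterm_def divide_inverse add.commute)
    then show False
      using not_summable_harmonic[where ?'a = real] summable_iff_shift[of "\<lambda>i. inverse (real i)" 4] by simp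
  qed
  then obtain p where "r \<le> (\<Sum>i<p. rterm 1 (i + 3))"
    using summableI_nonneg_bounded[of "\<lambda>i. rterm 1 (i + 3)" r] rterm_pos
    by (meson less_imp_le linear)
  also have "(\<Sum>i<p. rterm 1 (i + 3)) = (\<Sum>i = 3..<p + 3. rterm 1 i)"
    using sum.shift_bounds_nat_ivl[of "rterm 1" 0 3 p] by (simp add: atLeast0LessThan)
  finally obtain q t where q: "reach 1 3 r q t" "0 < t" "t \<le> rterm 1 q"
    using reach_descend r by blast
  moreover have "reach 1 1 x q t"
    using r q reach_trans by blast
  moreover have "3 \<le> q" using q by (simp add: reach_def)
  ultimately show ?thesis by blast
qed

lemma rterm_sums_exists:
  assumes "0 < x"
  shows "\<exists>h. (\<forall>n\<ge>1. 1 \<le> h n) \<and> filterlim h at_top sequentially \<and>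
             (\<lambda>n. rterm (h (Suc n)) (Suc n)) sums x"
proof -
  define res where "res f n = x - (\<Sum>i = 1..<n. rterm (f i) i)" for f :: "nat \<Rightarrow> nat" and n
  \<comment> \<open>A state pairs the next free index with a choice function that is final below it.
    Stages count from 0 and levels from 1, hence \<open>Suc k\<close>.\<close>
  define P where "P k S \<longleftrightarrow> (case S of (n, f) \<Rightarrow> 3 * (Suc k)\<^sup>2 \<le> n \<and> (\<forall>i\<in>{1..<n}. 1 \<le> f i) \<and>
      0 < res f n \<and> res f n \<le> rterm (Suc k) n)" for k S
  define Q where "Q k S S' \<longleftrightarrow> (case S of (n, f) \<Rightarrow> case S' of (m, g) \<Rightarrow>
      n < m \<and> (\<forall>i<n. g i = f i) \<and> (\<forall>i\<in>{n..<m}. Suc k \<le> g i))"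
    for k :: nat and S S' :: "nat \<times> (nat \<Rightarrow> nat)"
  have "\<exists>S. P 0 S"
  proof -
    obtain m s where ms: "reach 1 1 x m s" "3 \<le> m" "0 < s" "s \<le> rterm 1 m"
      using reach_start[OF assms] by blast
    then obtain g where "\<forall>i\<in>{1..<m}. 1 \<le> g i" "s = res g m"
      by (auto simp: reach_def res_def)
    with ms have "P 0 (m, g)"
      by (simp add: P_def)
    then show ?thesis ..
  qed
  moreover have "\<exists>S'. P (Suc k) S' \<and> Q k S S'" if "P k S" for k S
  proof -
    obtain n f where S: "S = (n, f)" by (cases S)
    have n: "3 * (Suc k)\<^sup>2 \<le> n" and f: "\<forall>i\<in>{1..<n}. 1 \<le> f i"
      and r: "0 < res f n" "res f n \<le> rterm (Suc k) n"
      using that by (auto simp: P_def S)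
    obtain m s where ms: "reach (Suc k) n (res f n) m s" "n < m" "3 * (Suc (Suc k))\<^sup>2 \<le> m"
        "0 < s" "s \<le> rterm (Suc (Suc k)) m"
      using reach_next_level[OF _ n r] by force
    obtain g where g: "\<forall>i\<in>{n..<m}. Suc k \<le> g i"
        "s = res f n - (\<Sum>i = n..<m. rterm (g i) i)"
      using ms(1) by (auto simp: reach_def)
    define h where "h = (\<lambda>i. if i < n then f i else g i)"
    have "1 \<le> n" using n by (cases n) auto
    then have "(\<Sum>i = 1..<m. rterm (h i) i) = (\<Sum>i = 1..<n. rterm (h i) i) + (\<Sum>i = n..<m. rterm (h i) i)"
      using ms by (simp add: sum.atLeastLessThan_concat)
    also have "\<dots> = (\<Sum>i = 1..<n. rterm (f i) i) + (\<Sum>i = n..<m. rterm (g i) i)"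
      by (intro arg_cong2[of _ _ _ _ "(+)"] sum.cong) (auto simp: h_def)
    finally have "s = res h m"
      by (simp add: g res_def)
    moreover have "1 \<le> h i" if "i \<in> {1..<m}" for i
      using that f g(1) by (cases "i < n") (auto simp: h_def dest!: bspec[of _ _ i])
    ultimately have "P (Suc k) (m, h)"
      using ms by (simp add: P_def)
    moreover have "Q k S (m, h)"
      using ms g by (simp add: Q_def S h_def)
    ultimately show ?thesis by blast
  qed
  ultimately obtain S where PS: "P k (S k)" and QS: "Q k (S k) (S (Suc k))" for k
    using dependent_nat_choice[of P Q] by blast
  define N where "N k = fst (S k)" for k
  define F where "F k = snd (S k)" for k
  have N: "3 * (Suc k)\<^sup>2 \<le> N k" and F1: "i \<in> {1..<N k} \<Longrightarrow> 1 \<le> F k i"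
    and res_pos: "0 < res (F k) (N k)" and res_le: "res (F k) (N k) \<le> rterm (Suc k) (N k)" for k i
    using PS[of k] by (auto simp: P_def N_def F_def split: prod.splits)
  have N_Suc: "N k < N (Suc k)" and F_Suc: "i < N k \<Longrightarrow> F (Suc k) i = F k i"
    and F_ge: "i \<in> {N k..<N (Suc k)} \<Longrightarrow> Suc k \<le> F (Suc k) i" for k i
    using QS[of k] by (auto simp: Q_def N_def F_def split: prod.splits)
  have N_mono: "strict_mono N"
    by (rule strict_mono_Suc_iff[THEN iffD2]) (use N_Suc in blast)
  have N_gt: "k < N k" for k
    using N[of k] by (simp add: power2_eq_square)
  have F_stable: "F l i = F k i" if "k \<le> l" "i < N k" for k l i
    using that(1)
  proof (induction rule: dec_induct)
    case (step l)
    then have "i < N l"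
      using that strict_mono_less_eq[OF N_mono, of k l] by linarith
    then show ?case using step F_Suc by simp
  qed simp
  \<comment> \<open>This makes the final sequence tend to infinity: the passage from stage
    \<open>l\<close> to \<open>Suc l\<close> adds only values of at least
    \<open>Suc l\<close>.\<close>
  have F_large: "Suc k \<le> F l i" if "k \<le> l" "i \<in> {N k..<N l}" for k l i
    using that
  proof (induction arbitrary: i rule: dec_induct)
    case (step l)
    show ?case
    proof (cases "i < N l")
      case True
      then show ?thesis using step F_Suc by auto
    next
      case False
      then show ?thesis using step F_ge[of i l] by auto
    qed
  qed simp
  \<comment> \<open>The diagonal is well chosen because \<open>i < N i\<close>: the value at
    \<open>i\<close> is final from stage \<open>i\<close> on.\<close>
  define h where "h i = F i i" for i
  have h_eq: "h i = F k i" if "i < N k" for i k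
    using F_stable[of i k i] F_stable[of k i i] that N_gt[of i] unfolding h_def by (cases "i \<le> k") auto
  have h1: "1 \<le> h i" if "1 \<le> i" for i
    unfolding h_def using F1[of i i] that N_gt[of i] by auto
  have "filterlim h at_top sequentially"
    unfolding filterlim_at_top eventually_sequentially
  proof (intro allI exI impI)
    fix k i assume "N k \<le> i"
    then have "k \<le> i" using N_gt[of k] by simp
    then show "k \<le> h i"
      using F_large[of k i i] \<open>N k \<le> i\<close> N_gt[of i] by (simp add: h_def)
  qed
  moreover have "(\<lambda>n. rterm (h (Suc n)) (Suc n)) sums x"
  proof -
    define s where "s n = (\<Sum>i<n. rterm (h (Suc i)) (Suc i))" for n
    have s_eq: "s n = (\<Sum>i = 1..<Suc n. rterm (h i) i)" for n
      unfolding s_def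
      using sum.shift_bounds_Suc_ivl[of "\<lambda>i. rterm (h i) i" 0 n] by (simp add: atLeast0LessThan)
    \<comment> \<open>\<open>s n\<close> covers the indices from 1 to \<open>n\<close>, so the
      indices below \<open>N k\<close> correspond to \<open>N k - 1\<close>.\<close>
    have s_N: "s (N k - 1) = x - res (F k) (N k)" for k
    proof -
      have "s (N k - 1) = (\<Sum>i = 1..<N k. rterm (h i) i)"
        using N_gt[of k] by (simp add: s_eq)
      also have "\<dots> = (\<Sum>i = 1..<N k. rterm (F k i) i)"
        by (intro sum.cong) (auto simp: h_eq)
      finally show ?thesis by (simp add: res_def)
    qed
    have "s n \<le> x" for n
    proof -
      have "s n \<le> s (N n - 1)"
        unfolding s_def using N_gt[of n] rterm_pos by (intro sum_mono2) (auto simp: less_imp_le)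
      then show ?thesis using s_N[of n] res_pos[of n] by linarith
    qed
    then have "summable (\<lambda>n. rterm (h (Suc n)) (Suc n))"
      using rterm_pos by (intro summableI_nonneg_bounded[of _ x]) (auto simp: less_imp_le s_def)
    then obtain y where y: "(\<lambda>n. rterm (h (Suc n)) (Suc n)) sums y"
      by (auto simp: summable_def)
    \<comment> \<open>The sum exists by monotonicity; its value is identified along the ends of the
      stages, where the remainder is squeezed to 0.\<close>
    have "strict_mono (\<lambda>k. N k - 1)"
      unfolding strict_mono_Suc_iff
    proof
      fix k show "N k - 1 < N (Suc k) - 1"
        using N_Suc[of k] N_gt[of k] by linarith
    qed
    moreover have "s \<longlonglongrightarrow> y"
      using y unfolding sums_def s_def .
    ultimately have "(\<lambda>k. s (N k - 1)) \<longlonglongrightarrow> y"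
      using LIMSEQ_subseq_LIMSEQ[of s y "\<lambda>k. N k - 1"] by (simp add: o_def)
    moreover have "(\<lambda>k. s (N k - 1)) \<longlonglongrightarrow> x"
    proof -
      have "(\<lambda>k. res (F k) (N k)) \<longlonglongrightarrow> 0"
      proof (rule tendsto_sandwich[OF _ _ tendsto_const])
        show "\<forall>\<^sub>F k in sequentially. 0 \<le> res (F k) (N k)"
          using res_pos by (simp add: less_imp_le)
        show "\<forall>\<^sub>F k in sequentially. res (F k) (N k) \<le> rterm 1 (N k)"
          using order_trans[OF res_le rterm_antimono[of 1]] by simp
        show "(\<lambda>k. rterm 1 (N k)) \<longlonglongrightarrow> 0"
          using LIMSEQ_subseq_LIMSEQ[OF rterm_tendsto_0[of 1] N_mono] by (simp add: o_def)
      qed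
      then show ?thesis
        unfolding s_N using tendsto_diff[OF tendsto_const[of x]] by fastforce
    qed
    ultimately show ?thesis using y LIMSEQ_unique by blast
  qed
  ultimately show ?thesis using h1 by blast
qed

section \<open>Convergence of every series in the set, and the equality\<close>

text \<open>The values of \<open>f\<close> are eventually at least 2, so the terms are dominated by
  inverse squares. Positivity of the \<open>suminf\<close> in the theorem rests on this.\<close>

lemma summable_rterm:
  assumes "filterlim f at_top sequentially"
  shows "summable (\<lambda>n. rterm (f (Suc n)) (Suc n))"
proof -
  have "\<forall>\<^sub>F n in sequentially. 2 \<le> f n"
    using assms by (simp add: filterlim_at_top)
  then have ev: "\<forall>\<^sub>F n in sequentially. 2 \<le> f (Suc n)"
    by (rule eventually_sequentially_Suc[THEN iffD2])
  have bound: "norm (rterm (f (Suc n)) (Suc n)) \<le> inverse (real (Suc n) ^ 2)" if "2 \<le> f (Suc n)" for n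
  proof -
    have "rterm (f (Suc n)) (Suc n) \<le> rterm 2 (Suc n)"
      using that by (rule rterm_antimono)
    also have "\<dots> = 1 / ((real n + 2) * (real n + 3))"
      by (simp add: rterm_Suc rterm_0 numeral_2_eq_2 add.commute)
    also have "\<dots> \<le> 1 / (real (Suc n))\<^sup>2"
      unfolding power2_eq_square by (intro divide_left_mono mult_mono mult_pos_pos) auto
    finally show ?thesis using rterm_pos[of "f (Suc n)" "Suc n"] by (simp add: divide_inverse)
  qed
  have "summable (\<lambda>n. inverse (real (Suc n) ^ 2))"
    using inverse_power_summable[of 2, where ?'a = real] summable_Suc_iff[of "\<lambda>n. inverse (real n ^ 2)"] by simp
  then show ?thesis
    by (rule summable_comparison_test_ev[rotated]) (use ev bound in \<open>auto elim: eventually_mono\<close>)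
qed

theorem theorem1:
  "{\<Sum>n. 1 / (\<Prod>i = 1..f (Suc n). real (Suc n + i)) | f :: nat \<Rightarrow> nat.
      (\<forall>n\<ge>1. f n \<ge> 1) \<and> filterlim f at_top sequentially}
   = {0::real<..}"
proof (intro equalityI subsetI)
  fix x :: real
  assume "x \<in> {\<Sum>n. 1 / (\<Prod>i = 1..f (Suc n). real (Suc n + i)) | f :: nat \<Rightarrow> nat.
      (\<forall>n\<ge>1. f n \<ge> 1) \<and> filterlim f at_top sequentially}"
  then obtain f where f: "filterlim f at_top sequentially"
    and x: "x = (\<Sum>n. rterm (f (Suc n)) (Suc n))"
    unfolding rterm_def by blast
  show "x \<in> {0<..}"
    using suminf_pos[OF summable_rterm[OF f]] rterm_pos x by simp
next
  fix x :: real
  assume "x \<in> {0<..}"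
  then obtain h where "\<forall>n\<ge>1. 1 \<le> h n" "filterlim h at_top sequentially"
    "(\<lambda>n. rterm (h (Suc n)) (Suc n)) sums x"
    using rterm_sums_exists by auto
  moreover from this(3) have "x = (\<Sum>n. 1 / (\<Prod>i = 1..h (Suc n). real (Suc n + i)))"
    unfolding rterm_def by (simp add: sums_unique)
  ultimately show "x \<in> {\<Sum>n. 1 / (\<Prod>i = 1..f (Suc n). real (Suc n + i)) | f :: nat \<Rightarrow> nat.
      (\<forall>n\<ge>1. f n \<ge> 1) \<and> filterlim f at_top sequentially}"
    by blast
qed

end
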